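(* Let $(X,\mathcal{A})$ be a measurable space with a measure $m$, and let $\mathcal{E}\colon L^2(X,m)\to[0,\infty]$ be a lower semicontinuous functional. The following assertions are equivalent: (i) $\mathcal{E}$ has the contraction property, i.e. it is compatible with every normal contraction $C\colon\mathbb{R}\to\mathbb{R}$. (ii) $\mathcal{E}$ is compatible with the normal contraction $|\cdot|\colon\mathbb{R}\to\mathbb{R}$, $x\mapsto|x|$, and with the normal contractions $$C_\alpha\colon\mathbb{R}\to\mathbb{R},\quad x\mapsto(-\alpha-x)\vee x\wedge(\alpha-x)$$ for all $\alpha\geq 0$. (iii) For all $f,g\in L^2(X,m)$ and all $\alpha\geq 0$, $$\mathcal{E}(f\vee g)+\mathcal{E}(f\wedge g)\leq\mathcal{E}(f)+\mathcal{E}(g),$$ $$\mathcal{E}(H_\alpha(f,g))+\mathcal{E}(H_\alpha(g,f))\leq\mathcal{E}(f)+\mathcal{E}(g),$$ where $H_\alpha(f,g)=(g-\alpha)\vee f\wedge(g+\alpha)$.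
   Context: $L^2(X,m)$ is the real Hilbert space of square-integrable functions. A normal contraction is a function $C\colon\mathbb{R}\to\mathbb{R}$ with $C(0)=0$ and $|C(x)-C(y)|\leq|x-y|$ for all $x,y\in\mathbb{R}$; $Cg$ denotes the composition $C\circ g$. The functional $\mathcal{E}$ is compatible with the normal contraction $C$ if for all $f,g\in L^2(X,m)$, $$\mathcal{E}(f+Cg)+\mathcal{E}(f-Cg)\leq\mathcal{E}(f+g)+\mathcal{E}(f-g).$$ Notation: $a\wedge b=\min(a,b)$, $a\vee b=\max(a,b)$, applied pointwise to functions; for $a\leq b$, $a\vee x\wedge b=\max(a,\min(x,b))$. *)

theory Defs
  imports "HOL-Analysis.Analysis"
begin

definition square_integrable :: "'a measure \<Rightarrow> ('a \<Rightarrow> real) set" where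
  "square_integrable M = {f \<in> borel_measurable M. integrable M (\<lambda>x. (f x)\<^sup>2)}"

(* The element of L^2(M) represented by f. A functional on L^2(M) is a function E of such
   classes; quantifying over f \<in> square_integrable M in E (L2_class M f) ranges over
   all of L^2(M), and E is never evaluated elsewhere. *)
definition L2_class :: "'a measure \<Rightarrow> ('a \<Rightarrow> real) \<Rightarrow> ('a \<Rightarrow> real) set" where
  "L2_class M f = {h \<in> square_integrable M. AE x in M. h x = f x}"

lemma L2_class_eq_iff:
  assumes "f \<in> square_integrable M" "g \<in> square_integrable M"
  shows "L2_class M f = L2_class M g \<longleftrightarrow> (AE x in M. f x = g x)"
proof
  assume "L2_class M f = L2_class M g"
  moreover have "f \<in> L2_class M f"
    using assms by (simp add: L2_class_def)
  ultimately show "AE x in M. f x = g x"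
    by (simp add: L2_class_def)
next
  assume eq: "AE x in M. f x = g x"
  have "(AE x in M. h x = f x) \<longleftrightarrow> (AE x in M. h x = g x)" for h
    using eq by (intro eventually_subst) (auto elim: eventually_mono)
  then show "L2_class M f = L2_class M g"
    by (simp add: L2_class_def)
qed

definition L2_norm :: "'a measure \<Rightarrow> ('a \<Rightarrow> real) \<Rightarrow> real" where
  "L2_norm M f = sqrt (\<integral>x. (f x)\<^sup>2 \<partial>M)"

(* Lower semicontinuity for the norm topology of L^2(M). *)
definition L2_lower_semicontinuous :: "'a measure \<Rightarrow> (('a \<Rightarrow> real) set \<Rightarrow> ennreal) \<Rightarrow> bool" where
  "L2_lower_semicontinuous M E \<longleftrightarrow>
    (\<forall>f \<in> square_integrable M. \<forall>c < E (L2_class M f).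
      \<exists>\<delta>>0. \<forall>g \<in> square_integrable M.
        L2_norm M (\<lambda>x. g x - f x) < \<delta> \<longrightarrow> c < E (L2_class M g))"

definition normal_contraction :: "(real \<Rightarrow> real) \<Rightarrow> bool" where
  "normal_contraction C \<longleftrightarrow> C 0 = 0 \<and> (\<forall>x y. \<bar>C x - C y\<bar> \<le> \<bar>x - y\<bar>)"

definition compatible ::
  "'a measure \<Rightarrow> (('a \<Rightarrow> real) set \<Rightarrow> ennreal) \<Rightarrow> (real \<Rightarrow> real) \<Rightarrow> bool" where
  "compatible M E C \<longleftrightarrow>
    (\<forall>f \<in> square_integrable M. \<forall>g \<in> square_integrable M.
      E (L2_class M (\<lambda>x. f x + C (g x))) + E (L2_class M (\<lambda>x. f x - C (g x)))
      \<le> E (L2_class M (\<lambda>x. f x + g x)) + E (L2_class M (\<lambda>x. f x - g x)))"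

definition contraction_property :: "'a measure \<Rightarrow> (('a \<Rightarrow> real) set \<Rightarrow> ennreal) \<Rightarrow> bool" where
  "contraction_property M E \<longleftrightarrow> (\<forall>C. normal_contraction C \<longrightarrow> compatible M E C)"

definition C_contr :: "real \<Rightarrow> real \<Rightarrow> real" where
  "C_contr \<alpha> x = max (- \<alpha> - x) (min x (\<alpha> - x))"

lemma normal_contraction_abs: "normal_contraction abs"
  by (simp add: normal_contraction_def abs_triangle_ineq3)

lemma normal_contraction_C_contr: "0 \<le> \<alpha> \<Longrightarrow> normal_contraction (C_contr \<alpha>)"
  unfolding normal_contraction_def C_contr_def by (smt (verit))

definition H_trunc :: "real \<Rightarrow> ('a \<Rightarrow> real) \<Rightarrow> ('a \<Rightarrow> real) \<Rightarrow> 'a \<Rightarrow> real" where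
  "H_trunc \<alpha> f g x = max (g x - \<alpha>) (min (f x) (g x + \<alpha>))"

(* The remaining lemmas show that the functions to which compatibility and the lattice and
   truncation inequalities apply E are again square integrable. *)
lemma square_integrable_dominated:
  assumes "f \<in> square_integrable M" "g \<in> square_integrable M" "h \<in> borel_measurable M"
    and "\<And>x. \<bar>h x\<bar> \<le> \<bar>f x\<bar> + \<bar>g x\<bar>"
  shows "h \<in> square_integrable M"
proof -
  have "(h x)\<^sup>2 \<le> 2 * (f x)\<^sup>2 + 2 * (g x)\<^sup>2" for x
  proof -
    have "(h x)\<^sup>2 \<le> (\<bar>f x\<bar> + \<bar>g x\<bar>)\<^sup>2"
      using assms(4)[of x] by (metis abs_ge_zero power2_abs power_mono)
    also have "\<dots> \<le> 2 * (f x)\<^sup>2 + 2 * (g x)\<^sup>2"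
      using sum_squares_bound[of "\<bar>f x\<bar>" "\<bar>g x\<bar>"] by (simp add: power2_sum)
    finally show ?thesis .
  qed
  then have le: "AE x in M. norm ((h x)\<^sup>2) \<le> norm (2 * (f x)\<^sup>2 + 2 * (g x)\<^sup>2)"
    by (intro AE_I2) simp
  have int: "integrable M (\<lambda>x. 2 * (f x)\<^sup>2 + 2 * (g x)\<^sup>2)"
    using assms(1,2) unfolding square_integrable_def by simp
  have "(\<lambda>x. (h x)\<^sup>2) \<in> borel_measurable M"
    using assms(3) by measurable
  with int have "integrable M (\<lambda>x. (h x)\<^sup>2)"
    using le by (rule Bochner_Integration.integrable_bound)
  then show ?thesis
    using assms(3) by (simp add: square_integrable_def)
qed

lemma square_integrable_contraction:
  assumes "normal_contraction C" "f \<in> square_integrable M" "g \<in> square_integrable M"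
  shows "(\<lambda>x. f x + C (g x)) \<in> square_integrable M"
    and "(\<lambda>x. f x - C (g x)) \<in> square_integrable M"
proof -
  have lip: "\<bar>C x - C y\<bar> \<le> \<bar>x - y\<bar>" and C0: "C 0 = 0" for x y
    using assms(1) by (auto simp: normal_contraction_def)
  have bound: "\<bar>C x\<bar> \<le> \<bar>x\<bar>" for x
    using lip[of x 0] C0 by simp
  have "1-lipschitz_on UNIV C"
    using lip by (auto simp: lipschitz_on_def dist_real_def)
  then have [measurable]: "C \<in> borel_measurable borel"
    by (intro borel_measurable_continuous_onI lipschitz_on_continuous_on)
  have [measurable]: "f \<in> borel_measurable M" "g \<in> borel_measurable M"
    using assms(2,3) by (auto simp: square_integrable_def)
  show "(\<lambda>x. f x + C (g x)) \<in> square_integrable M"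
  proof (rule square_integrable_dominated[OF assms(2,3)])
    show "\<bar>f x + C (g x)\<bar> \<le> \<bar>f x\<bar> + \<bar>g x\<bar>" for x
      using bound[of "g x"] by linarith
  qed measurable
  show "(\<lambda>x. f x - C (g x)) \<in> square_integrable M"
  proof (rule square_integrable_dominated[OF assms(2,3)])
    show "\<bar>f x - C (g x)\<bar> \<le> \<bar>f x\<bar> + \<bar>g x\<bar>" for x
      using bound[of "g x"] by linarith
  qed measurable
qed

lemma square_integrable_lattice:
  assumes "f \<in> square_integrable M" "g \<in> square_integrable M"
  shows "(\<lambda>x. max (f x) (g x)) \<in> square_integrable M"
    and "(\<lambda>x. min (f x) (g x)) \<in> square_integrable M"
    and "0 \<le> \<alpha> \<Longrightarrow> H_trunc \<alpha> f g \<in> square_integrable M"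
proof -
  have [measurable]: "f \<in> borel_measurable M" "g \<in> borel_measurable M"
    using assms by (auto simp: square_integrable_def)
  show "(\<lambda>x. max (f x) (g x)) \<in> square_integrable M"
  proof (rule square_integrable_dominated[OF assms])
    show "\<bar>max (f x) (g x)\<bar> \<le> \<bar>f x\<bar> + \<bar>g x\<bar>" for x
      by linarith
  qed measurable
  show "(\<lambda>x. min (f x) (g x)) \<in> square_integrable M"
  proof (rule square_integrable_dominated[OF assms])
    show "\<bar>min (f x) (g x)\<bar> \<le> \<bar>f x\<bar> + \<bar>g x\<bar>" for x
      by linarith
  qed measurable
  show "H_trunc \<alpha> f g \<in> square_integrable M" if "0 \<le> \<alpha>"
  proof (rule square_integrable_dominated[OF assms])
    show "H_trunc \<alpha> f g \<in> borel_measurable M"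
      unfolding H_trunc_def[abs_def] by measurable
    show "\<bar>H_trunc \<alpha> f g x\<bar> \<le> \<bar>f x\<bar> + \<bar>g x\<bar>" for x
      using that unfolding H_trunc_def by linarith
  qed
qed

end

theory Submission
  imports Defs
begin

text \<open>
  Suppose first that \<open>E\<close> is a smooth function on \<open>\<real>\<^sup>n\<close>. Infinitesimally, the lattice inequality
  says that the off-diagonal second derivatives are nonpositive, and the truncation inequality
  that the rows of the Hessian have nonnegative sums. So the Hessian is
  \<open>\<Sum> w\<^sub>i\<^sub>j (z\<^sub>i - z\<^sub>j)\<^sup>2 + \<Sum> k\<^sub>i z\<^sub>i\<^sup>2\<close> with \<open>w, k \<ge> 0\<close>, a form that is nonnegative on every pair
  \<open>(a, b)\<close> of comonotone vectors, that is, \<open>(a\<^sub>i - a\<^sub>j) (b\<^sub>i - b\<^sub>j) \<ge> 0\<close> and \<open>a\<^sub>i b\<^sub>i \<ge> 0\<close>. Integrating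
  over a parallelogram gives \<open>E(z + a) + E(z + b) \<le> E(z) + E(z + a + b)\<close>. For a normal contraction
  \<open>C\<close> the vectors \<open>a = g + C g\<close> and \<open>b = g - C g\<close> are comonotone, and \<open>z = f - g\<close> yields exactly
  compatibility with \<open>C\<close>.

  The proof follows this picture without derivatives. The parallelogram inequality, required for
  all \<open>z\<close>, is the relation \<open>exchange\<close> between \<open>a\<close> and \<open>b\<close>. It behaves like nonnegativity of a
  bilinear form: it is additive in each argument (lemma \<open>exchange_add\<close>), although one further
  instance is needed there to know that the energies to be cancelled are finite. The lattice
  inequality provides it for a nonnegative and a nonpositive function with disjoint supports
  (\<open>exchange_opposite_signs\<close>), the truncation inequality for \<open>w, v \<ge> 0\<close> such that \<open>v\<close> attains its
  upper bound wherever \<open>w > 0\<close> (\<open>exchange_above\<close>).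

  Cut a function \<open>u \<ge> 0\<close> into horizontal layers of height \<open>\<epsilon>\<close>. By the truncation inequality each
  layer is exchangeable with any sum of lower ones, so by additivity any two sums of disjoint sets
  of layers are exchangeable (\<open>exchange_layers\<close>). A nondecreasing 1-Lipschitz function \<open>A\<close> with
  \<open>A(0) = 0\<close> is approximated within \<open>2 \<epsilon>\<close> by selecting layers (\<open>layers_approximate\<close>), whence
  \<open>A u\<close> and \<open>u - A u\<close> are exchangeable by lower semicontinuity
  (\<open>exchange_monotone_split\<close>). This settles the positive and the negative part of \<open>g\<close>, and
  \<open>exchange_combine_signs\<close> joins them.

  Conversely, compatibility with \<open>\<bar>\<cdot>\<bar>\<close> and \<open>C\<^sub>\<alpha>\<close> turns into the lattice and truncation inequalities
  by passing to the half sum and half difference of the two functions.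
\<close>

section \<open>Square integrable functions form a vector space\<close>

lemma square_integrable_add:
  assumes "f \<in> square_integrable M" "g \<in> square_integrable M"
  shows "(\<lambda>x. f x + g x) \<in> square_integrable M"
proof -
  have [measurable]: "f \<in> borel_measurable M" "g \<in> borel_measurable M"
    using assms by (auto simp: square_integrable_def)
  show ?thesis
    by (rule square_integrable_dominated[OF assms])
       (simp_all add: abs_triangle_ineq)
qed

lemma square_integrable_scale:
  assumes "f \<in> square_integrable M"
  shows "(\<lambda>x. c * f x) \<in> square_integrable M"
  using assms by (auto simp: square_integrable_def power_mult_distrib)

lemma square_integrable_uminus:
  assumes "f \<in> square_integrable M"
  shows "(\<lambda>x. - f x) \<in> square_integrable M"
  using square_integrable_scale[OF assms, of "-1"] by simp

lemma square_integrable_diff: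
  assumes "f \<in> square_integrable M" "g \<in> square_integrable M"
  shows "(\<lambda>x. f x - g x) \<in> square_integrable M"
  using square_integrable_add[OF assms(1) square_integrable_uminus[OF assms(2)]] by simp

lemma square_integrable_zero: "(\<lambda>x. 0) \<in> square_integrable M"
  by (simp add: square_integrable_def)

lemma square_integrable_sum:
  assumes "\<And>i. i \<in> S \<Longrightarrow> f i \<in> square_integrable M"
  shows "(\<lambda>x. \<Sum>i\<in>S. f i x) \<in> square_integrable M"
  using assms
  by (induction S rule: infinite_finite_induct)
     (auto intro: square_integrable_zero square_integrable_add)

lemmas square_integrable_intros =
  square_integrable_add square_integrable_diff square_integrable_uminus
  square_integrable_zero square_integrable_sum

section \<open>The parallelogram inequality as a relation between increments\<close>

text \<open>
  The inequality is required at every base point \<open>z\<close>, so that it can be applied repeatedly along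
  a chain of increments.
\<close>

definition exchange ::
  "'a measure \<Rightarrow> (('a \<Rightarrow> real) set \<Rightarrow> ennreal) \<Rightarrow> ('a \<Rightarrow> real) \<Rightarrow> ('a \<Rightarrow> real) \<Rightarrow> bool" where
  "exchange M E a b \<longleftrightarrow>
    (\<forall>z \<in> square_integrable M.
      E (L2_class M (\<lambda>x. z x + a x)) + E (L2_class M (\<lambda>x. z x + b x))
      \<le> E (L2_class M z) + E (L2_class M (\<lambda>x. z x + a x + b x)))"

lemma exchange_commute: "exchange M E a b \<longleftrightarrow> exchange M E b a"
  by (simp add: exchange_def add_ac)

text \<open>
  The point reflection of a parallelogram at its centre is again the same parallelogram: the
  inequality for \<open>-a, -b\<close> at \<open>z\<close> is the one for \<open>a, b\<close> at \<open>z - a - b\<close>.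
\<close>

lemma exchange_uminus:
  assumes "a \<in> square_integrable M" "b \<in> square_integrable M" "exchange M E a b"
  shows "exchange M E (\<lambda>x. - a x) (\<lambda>x. - b x)"
  unfolding exchange_def
proof
  fix z assume "z \<in> square_integrable M"
  then have "(\<lambda>x. z x - a x - b x) \<in> square_integrable M"
    using assms by (intro square_integrable_intros)
  from assms(3)[unfolded exchange_def, rule_format, OF this]
  show "E (L2_class M (\<lambda>x. z x + - a x)) + E (L2_class M (\<lambda>x. z x + - b x))
      \<le> E (L2_class M z) + E (L2_class M (\<lambda>x. z x + - a x + - b x))"
    by (simp add: algebra_simps)
qed

text \<open>
  Adding the first two inequalities gives the claim after cancelling \<open>p + s\<close>. The third one
  guarantees that \<open>p\<close>, and then by the second one \<open>s\<close>, is finite when the right-hand side is.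
\<close>

lemma ennreal_add_cancel_chain:
  fixes p q r s t u w :: ennreal
  assumes "p + q \<le> r + s" "t + s \<le> p + u" "p + w \<le> r + u"
  shows "t + q \<le> r + u"
proof (cases "r + u = top")
  case False
  then have fin: "p \<noteq> top" "s \<noteq> top"
    using assms(2,3) by (auto simp: top_unique)
  have "(p + s) + (t + q) \<le> (p + s) + (r + u)"
    using add_mono[OF assms(1,2)] by (simp add: add_ac)
  then show ?thesis
    using fin by (simp add: ennreal_add_left_cancel_le)
next
  case True
  show ?thesis unfolding True by (rule top_greatest)
qed

text \<open>
  The parallelogram with sides \<open>x + y\<close> and \<open>b\<close> is glued from the one with sides \<open>x, b\<close> at \<open>z\<close> and
  the one with sides \<open>y, b\<close> at \<open>z + x\<close>. Their common vertices \<open>z + x\<close> and \<open>z + x + b\<close> may have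
  infinite energy; the parallelogram with sides \<open>x\<close> and \<open>y + b\<close> excludes this in the only case
  that matters, when the right-hand side is finite.
\<close>

lemma exchange_add:
  assumes "x \<in> square_integrable M"
    and "exchange M E x b" "exchange M E x (\<lambda>t. y t + b t)" "exchange M E y b"
  shows "exchange M E (\<lambda>t. x t + y t) b"
  unfolding exchange_def
proof
  fix z assume z: "z \<in> square_integrable M"
  then have zx: "(\<lambda>t. z t + x t) \<in> square_integrable M"
    using assms(1) by (rule square_integrable_add)
  show "E (L2_class M (\<lambda>t. z t + (x t + y t))) + E (L2_class M (\<lambda>t. z t + b t))
      \<le> E (L2_class M z) + E (L2_class M (\<lambda>t. z t + (x t + y t) + b t))"
  proof (rule ennreal_add_cancel_chain)
    show "E (L2_class M (\<lambda>t. z t + x t)) + E (L2_class M (\<lambda>t. z t + b t))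
        \<le> E (L2_class M z) + E (L2_class M (\<lambda>t. z t + x t + b t))"
      using assms(2) z by (simp add: exchange_def)
    show "E (L2_class M (\<lambda>t. z t + (x t + y t))) + E (L2_class M (\<lambda>t. z t + x t + b t))
        \<le> E (L2_class M (\<lambda>t. z t + x t)) + E (L2_class M (\<lambda>t. z t + (x t + y t) + b t))"
      using assms(4)[unfolded exchange_def, rule_format, OF zx] by (simp only: add.assoc)
    show "E (L2_class M (\<lambda>t. z t + x t)) + E (L2_class M (\<lambda>t. z t + (y t + b t)))
        \<le> E (L2_class M z) + E (L2_class M (\<lambda>t. z t + (x t + y t) + b t))"
      using assms(3)[unfolded exchange_def, rule_format, OF z] by (simp only: add.assoc)
  qed
qed

text \<open>
  Induction on the number of layers: the outermost layer \<open>l k\<close>, say with \<open>k \<in> I\<close>, plays the role of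
  \<open>x\<close> in the previous lemma. Both hypotheses on \<open>x\<close> then concern a sum of layers with smaller
  index, and the hypothesis on the remainder \<open>I - {k}\<close> is the induction hypothesis.
\<close>

lemma exchange_layers:
  fixes l :: "nat \<Rightarrow> 'a \<Rightarrow> real"
  assumes sq: "\<And>i. i < k \<Longrightarrow> l i \<in> square_integrable M"
    and outer: "\<And>n S. n < k \<Longrightarrow> S \<subseteq> {..<n} \<Longrightarrow> exchange M E (l n) (\<lambda>x. \<Sum>i\<in>S. l i x)"
    and "I \<inter> J = {}" "I \<union> J \<subseteq> {..<k}"
  shows "exchange M E (\<lambda>x. \<Sum>i\<in>I. l i x) (\<lambda>x. \<Sum>i\<in>J. l i x)"
  using assms
proof (induction k arbitrary: I J)
  case 0
  then show ?case by (auto simp: exchange_def)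
next
  case (Suc k)
  have step: "exchange M E (\<lambda>x. \<Sum>i\<in>I. l i x) (\<lambda>x. \<Sum>i\<in>J. l i x)"
    if "k \<in> I" and disj: "I \<inter> J = {}" and sub: "I \<union> J \<subseteq> {..<Suc k}" for I J
  proof -
    have fin: "finite I" "finite J"
      using sub finite_subset[of _ "{..<Suc k}"] by auto
    have below: "I - {k} \<subseteq> {..<k}" "J \<subseteq> {..<k}"
      using that by (fastforce simp: less_Suc_eq)+
    have "exchange M E (l k) (\<lambda>x. \<Sum>i\<in>I - {k} \<union> J. l i x)"
      using below by (intro Suc.prems(2)) auto
    moreover have "(\<Sum>i\<in>I - {k} \<union> J. l i x) = (\<Sum>i\<in>I - {k}. l i x) + (\<Sum>i\<in>J. l i x)" for x
      using fin disj by (intro sum.union_disjoint) auto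
    ultimately have all:
      "exchange M E (l k) (\<lambda>x. (\<Sum>i\<in>I - {k}. l i x) + (\<Sum>i\<in>J. l i x))"
      by simp
    have "exchange M E (\<lambda>x. l k x + (\<Sum>i\<in>I - {k}. l i x)) (\<lambda>x. \<Sum>i\<in>J. l i x)"
    proof (rule exchange_add[OF _ _ all])
      show "exchange M E (\<lambda>x. \<Sum>i\<in>I - {k}. l i x) (\<lambda>x. \<Sum>i\<in>J. l i x)"
        using below disj by (intro Suc.IH Suc.prems(1,2)) auto
    qed (use below in \<open>auto intro!: Suc.prems(1,2)\<close>)
    then show ?thesis
      using fin \<open>k \<in> I\<close> by (simp add: sum.remove)
  qed
  consider "k \<in> I" | "k \<in> J" | "k \<notin> I \<union> J" by blast
  then show ?case
  proof cases
    case 1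
    then show ?thesis using step Suc.prems by blast
  next
    case 2
    then have "exchange M E (\<lambda>x. \<Sum>i\<in>J. l i x) (\<lambda>x. \<Sum>i\<in>I. l i x)"
      using Suc.prems by (intro step) auto
    then show ?thesis by (simp add: exchange_commute)
  next
    case 3
    then have "I \<union> J \<subseteq> {..<k}"
      using Suc.prems(4) less_Suc_eq by auto
    then show ?thesis
      using Suc.prems by (intro Suc.IH) auto
  qed
qed

section \<open>Layers and the approximation of monotone functions\<close>

definition layer :: "real \<Rightarrow> nat \<Rightarrow> real \<Rightarrow> real" where
  "layer \<epsilon> i t = min \<epsilon> (max 0 (t - real i * \<epsilon>))"

lemma sum_layers:
  assumes "0 \<le> \<epsilon>" "0 \<le> t"
  shows "(\<Sum>i<N. layer \<epsilon> i t) = min t (real N * \<epsilon>)"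
proof (induction N)
  case (Suc N)
  show ?case
    unfolding sum.lessThan_Suc Suc.IH unfolding layer_def of_nat_Suc distrib_right
    using assms by linarith
qed (use assms in simp)

text \<open>
  Selecting a set \<open>I\<close> of layers amounts to a piecewise linear function with slopes 0 and 1. A layer
  is taken exactly when \<open>\<lfloor>A / \<epsilon>\<rfloor>\<close> increases across it. Since \<open>A\<close> is nondecreasing and 1-Lipschitz,
  this increase is at most 1, so the sum of the layers taken up to a grid point \<open>k \<epsilon>\<close> is
  \<open>\<epsilon> \<lfloor>A (k \<epsilon>) / \<epsilon>\<rfloor>\<close>.
\<close>

lemma layers_approximate:
  fixes A :: "real \<Rightarrow> real"
  assumes A0: "A 0 = 0"
    and A: "\<And>s t. 0 \<le> s \<Longrightarrow> s \<le> t \<Longrightarrow> A s \<le> A t \<and> A t \<le> A s + (t - s)"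
    and "0 < \<epsilon>"
  obtains I where "I \<subseteq> {..<N}"
    "\<And>t. 0 \<le> t \<Longrightarrow> t < real N * \<epsilon> \<Longrightarrow> \<bar>(\<Sum>i\<in>I. layer \<epsilon> i t) - A t\<bar> \<le> 2 * \<epsilon>"
proof -
  define m :: "nat \<Rightarrow> int" where "m i = \<lfloor>A (real i * \<epsilon>) / \<epsilon>\<rfloor>" for i
  define I where "I = {i. i < N \<and> m (Suc i) \<noteq> m i}"
  have m_step: "m (Suc i) = m i \<or> m (Suc i) = m i + 1" for i
  proof -
    have "A (real i * \<epsilon>) \<le> A (real (Suc i) * \<epsilon>)"
      "A (real (Suc i) * \<epsilon>) \<le> A (real i * \<epsilon>) + \<epsilon>"
      using A[of "real i * \<epsilon>" "real (Suc i) * \<epsilon>"] \<open>0 < \<epsilon>\<close> by (auto simp: algebra_simps)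
    then have "A (real i * \<epsilon>) / \<epsilon> \<le> A (real (Suc i) * \<epsilon>) / \<epsilon>"
      "A (real (Suc i) * \<epsilon>) / \<epsilon> \<le> A (real i * \<epsilon>) / \<epsilon> + 1"
      using \<open>0 < \<epsilon>\<close> by (auto simp: field_simps)
    then show ?thesis
      unfolding m_def by linarith
  qed
  show thesis
  proof
    show "I \<subseteq> {..<N}" by (auto simp: I_def)
    fix t :: real assume t: "0 \<le> t" "t < real N * \<epsilon>"
    \<comment> \<open>\<open>k\<close> is the index of the layer that contains \<open>t\<close>: lower layers are full, higher ones empty.\<close>
    define k where "k = nat \<lfloor>t / \<epsilon>\<rfloor>"
    have "real k = of_int \<lfloor>t / \<epsilon>\<rfloor>"
      using t \<open>0 < \<epsilon>\<close> by (simp add: k_def)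
    then have "real k \<le> t / \<epsilon>" "t / \<epsilon> < real k + 1" by linarith+
    then have k: "real k * \<epsilon> \<le> t" "t < real k * \<epsilon> + \<epsilon>"
      using \<open>0 < \<epsilon>\<close> by (auto simp: field_simps)
    then have "real k * \<epsilon> < real N * \<epsilon>" using t by linarith
    then have "k < N" using \<open>0 < \<epsilon>\<close> by simp
    define \<theta> :: "nat \<Rightarrow> real" where "\<theta> i = of_int (m (Suc i) - m i)" for i
    have \<theta>: "\<theta> i = (if i \<in> I then 1 else 0)" if "i < N" for i
      using m_step[of i] that by (auto simp: \<theta>_def I_def)
    have "(\<Sum>i\<in>I. layer \<epsilon> i t) = (\<Sum>i<N. \<theta> i * layer \<epsilon> i t)"
      by (rule sum.mono_neutral_cong_left) (auto simp: \<theta> I_def)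
    also have "\<dots> = (\<Sum>i<Suc k. \<theta> i * layer \<epsilon> i t)"
    proof (rule sum.mono_neutral_right)
      show "\<forall>i\<in>{..<N} - {..<Suc k}. \<theta> i * layer \<epsilon> i t = 0"
      proof
        fix i assume "i \<in> {..<N} - {..<Suc k}"
        then have "(real k + 1) * \<epsilon> \<le> real i * \<epsilon>"
          using \<open>0 < \<epsilon>\<close> by (intro mult_right_mono) auto
        then have "t \<le> real i * \<epsilon>" using k by (simp add: algebra_simps)
        then show "\<theta> i * layer \<epsilon> i t = 0" using \<open>0 < \<epsilon>\<close> by (simp add: layer_def)
      qed
    qed (use \<open>k < N\<close> in auto)
    also have "\<dots> = (\<Sum>i<k. \<theta> i * \<epsilon>) + \<theta> k * (t - real k * \<epsilon>)"
    proof -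
      have "layer \<epsilon> i t = \<epsilon>" if "i < k" for i
      proof -
        have "(real i + 1) * \<epsilon> \<le> real k * \<epsilon>"
          using that \<open>0 < \<epsilon>\<close> by (intro mult_right_mono) auto
        then show ?thesis
          using k \<open>0 < \<epsilon>\<close> by (simp add: layer_def algebra_simps)
      qed
      moreover have "layer \<epsilon> k t = t - real k * \<epsilon>"
        using k by (simp add: layer_def)
      ultimately show ?thesis by simp
    qed
    also have "(\<Sum>i<k. \<theta> i * \<epsilon>) = of_int (m k) * \<epsilon>"
    proof -
      have "m 0 = 0" by (simp add: m_def A0)
      then have "(\<Sum>i<k. \<theta> i) = of_int (m k)"
        unfolding \<theta>_def of_int_diff
        by (subst sum_lessThan_telescope[of "\<lambda>i. real_of_int (m i)" k]) simp
      then show ?thesis by (simp flip: sum_distrib_right)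
    qed
    finally have sum_eq:
      "(\<Sum>i\<in>I. layer \<epsilon> i t) = of_int (m k) * \<epsilon> + \<theta> k * (t - real k * \<epsilon>)" .
    have "0 \<le> \<theta> k * (t - real k * \<epsilon>)" "\<theta> k * (t - real k * \<epsilon>) \<le> \<epsilon>"
      using \<theta>[OF \<open>k < N\<close>] k \<open>0 < \<epsilon>\<close> by auto
    moreover have "of_int (m k) * \<epsilon> \<le> A (real k * \<epsilon>)" "A (real k * \<epsilon>) \<le> of_int (m k) * \<epsilon> + \<epsilon>"
    proof -
      have "of_int (m k) \<le> A (real k * \<epsilon>) / \<epsilon>" "A (real k * \<epsilon>) / \<epsilon> \<le> of_int (m k) + 1"
        unfolding m_def by linarith+
      then show "of_int (m k) * \<epsilon> \<le> A (real k * \<epsilon>)" "A (real k * \<epsilon>) \<le> of_int (m k) * \<epsilon> + \<epsilon>"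
        using \<open>0 < \<epsilon>\<close> by (auto simp: field_simps)
    qed
    moreover have "A (real k * \<epsilon>) \<le> A t" "A t \<le> A (real k * \<epsilon>) + \<epsilon>"
      using A[of "real k * \<epsilon>" t] k \<open>0 < \<epsilon>\<close> by auto
    ultimately show "\<bar>(\<Sum>i\<in>I. layer \<epsilon> i t) - A t\<bar> \<le> 2 * \<epsilon>"
      unfolding sum_eq by linarith
  qed
qed

section \<open>Lower semicontinuity and limits of increments\<close>

lemma L2_lower_semicontinuous_liminf:
  assumes lsc: "L2_lower_semicontinuous M E"
    and f: "f \<in> square_integrable M" and fn: "\<And>n. fn n \<in> square_integrable M"
    and lim: "(\<lambda>n. L2_norm M (\<lambda>x. fn n x - f x)) \<longlonglongrightarrow> 0"
  shows "E (L2_class M f) \<le> liminf (\<lambda>n. E (L2_class M (fn n)))"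
  unfolding le_Liminf_iff
proof (intro allI impI)
  fix c assume "c < E (L2_class M f)"
  then obtain \<delta> where \<delta>: "\<delta> > 0"
    "\<And>g. g \<in> square_integrable M \<Longrightarrow> L2_norm M (\<lambda>x. g x - f x) < \<delta> \<Longrightarrow> c < E (L2_class M g)"
    using lsc f unfolding L2_lower_semicontinuous_def by blast
  from order_tendstoD(2)[OF lim \<delta>(1)]
  show "\<forall>\<^sub>F n in sequentially. c < E (L2_class M (fn n))"
    by eventually_elim (use \<delta>(2) fn in blast)
qed

lemma liminf_add_le_bound:
  fixes p q :: "nat \<Rightarrow> ennreal"
  assumes "\<And>n. p n + q n \<le> r"
  shows "liminf p + liminf q \<le> r"
proof -
  have inc: "incseq (\<lambda>n. INF m\<in>{n..}. p m)" "incseq (\<lambda>n. INF m\<in>{n..}. q m)"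
    by (auto simp: incseq_def intro!: INF_superset_mono)
  have "liminf p + liminf q = (SUP n. (INF m\<in>{n..}. p m) + (INF m\<in>{n..}. q m))"
    unfolding liminf_SUP_INF by (rule ennreal_SUP_add[OF inc, symmetric])
  also have "\<dots> \<le> r"
  proof (rule SUP_least)
    fix n
    have "(INF m\<in>{n..}. p m) + (INF m\<in>{n..}. q m) \<le> p n + q n"
      by (intro add_mono INF_lower) auto
    with assms[of n] show "(INF m\<in>{n..}. p m) + (INF m\<in>{n..}. q m) \<le> r" by simp
  qed
  finally show ?thesis .
qed

text \<open>
  The sum \<open>u\<close> of the two increments is kept fixed along the sequence. Hence the right-hand side of
  the inequality is constant, and lower semicontinuity is used only on the left-hand side.
\<close>

lemma exchange_limit:
  assumes lsc: "L2_lower_semicontinuous M E"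
    and sq: "a \<in> square_integrable M" "u \<in> square_integrable M"
      "\<And>n. an n \<in> square_integrable M"
    and lim: "(\<lambda>n. L2_norm M (\<lambda>x. an n x - a x)) \<longlonglongrightarrow> 0"
    and ex: "\<And>n. exchange M E (an n) (\<lambda>x. u x - an n x)"
  shows "exchange M E a (\<lambda>x. u x - a x)"
  unfolding exchange_def
proof
  fix z assume z: "z \<in> square_integrable M"
  have "E (L2_class M (\<lambda>x. z x + a x)) \<le> liminf (\<lambda>n. E (L2_class M (\<lambda>x. z x + an n x)))"
    using lim by (intro L2_lower_semicontinuous_liminf[OF lsc] square_integrable_intros sq z) simp
  moreover have "(\<lambda>n. L2_norm M (\<lambda>x. (z x + (u x - an n x)) - (z x + (u x - a x)))) \<longlonglongrightarrow> 0"
    using lim by (simp add: L2_norm_def power2_commute)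
  then have "E (L2_class M (\<lambda>x. z x + (u x - a x)))
      \<le> liminf (\<lambda>n. E (L2_class M (\<lambda>x. z x + (u x - an n x))))"
    by (intro L2_lower_semicontinuous_liminf[OF lsc] square_integrable_intros sq z)
  ultimately have "E (L2_class M (\<lambda>x. z x + a x)) + E (L2_class M (\<lambda>x. z x + (u x - a x)))
      \<le> liminf (\<lambda>n. E (L2_class M (\<lambda>x. z x + an n x)))
        + liminf (\<lambda>n. E (L2_class M (\<lambda>x. z x + (u x - an n x))))"
    by (rule add_mono)
  also have "\<dots> \<le> E (L2_class M z) + E (L2_class M (\<lambda>x. z x + u x))"
    using ex[unfolded exchange_def, rule_format, OF z]
    by (intro liminf_add_le_bound) simp
  finally show "E (L2_class M (\<lambda>x. z x + a x)) + E (L2_class M (\<lambda>x. z x + (u x - a x)))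
      \<le> E (L2_class M z) + E (L2_class M (\<lambda>x. z x + a x + (u x - a x)))"
    by simp
qed

lemma L2_norm_tendsto_dominated:
  assumes sq: "a \<in> square_integrable M" "u \<in> square_integrable M"
      "\<And>n. an n \<in> square_integrable M"
    and pw: "\<And>x. (\<lambda>n. an n x) \<longlonglongrightarrow> a x"
    and dom: "\<And>n x. \<bar>an n x - a x\<bar> \<le> \<bar>u x\<bar>"
  shows "(\<lambda>n. L2_norm M (\<lambda>x. an n x - a x)) \<longlonglongrightarrow> 0"
proof -
  have [measurable]: "a \<in> borel_measurable M" "\<And>n. an n \<in> borel_measurable M"
    using sq by (auto simp: square_integrable_def)
  have "(\<lambda>n. \<integral>x. (an n x - a x)\<^sup>2 \<partial>M) \<longlonglongrightarrow> (\<integral>x. 0 \<partial>M)"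
  proof (rule integral_dominated_convergence[where w = "\<lambda>x. (u x)\<^sup>2"])
    show "integrable M (\<lambda>x. (u x)\<^sup>2)"
      using sq(2) by (simp add: square_integrable_def)
    show "AE x in M. (\<lambda>n. (an n x - a x)\<^sup>2) \<longlonglongrightarrow> 0"
    proof (rule AE_I2)
      fix x
      have "(\<lambda>n. (an n x - a x)\<^sup>2) \<longlonglongrightarrow> (a x - a x)\<^sup>2"
        by (intro tendsto_intros pw)
      then show "(\<lambda>n. (an n x - a x)\<^sup>2) \<longlonglongrightarrow> 0" by simp
    qed
    show "AE x in M. norm ((an n x - a x)\<^sup>2) \<le> (u x)\<^sup>2" for n
      using dom by (intro AE_I2) (simp add: abs_le_square_iff)
  qed measurable
  then have "(\<lambda>n. sqrt (\<integral>x. (an n x - a x)\<^sup>2 \<partial>M)) \<longlonglongrightarrow> sqrt 0"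
    by (intro tendsto_real_sqrt) simp
  then show ?thesis by (simp add: L2_norm_def)
qed

section \<open>Increments supplied by the truncation and lattice inequalities\<close>

text \<open>
  At the base point \<open>z\<close> and its opposite vertex \<open>z + w + v\<close>, which differ by \<open>w + v\<close>, truncation at
  the level \<open>c\<close> cuts off precisely \<open>w\<close>, because \<open>v = c\<close> wherever \<open>w > 0\<close>.
\<close>

lemma exchange_above:
  assumes H: "\<And>f g \<alpha>. f \<in> square_integrable M \<Longrightarrow> g \<in> square_integrable M \<Longrightarrow> 0 \<le> \<alpha> \<Longrightarrow>
      E (L2_class M (H_trunc \<alpha> f g)) + E (L2_class M (H_trunc \<alpha> g f))
        \<le> E (L2_class M f) + E (L2_class M g)"
    and sq: "w \<in> square_integrable M" "v \<in> square_integrable M"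
    and vw: "\<And>x. 0 \<le> w x" "\<And>x. 0 \<le> v x" "\<And>x. v x \<le> c" "\<And>x. 0 < w x \<Longrightarrow> v x = c"
    and "0 \<le> c"
  shows "exchange M E w v"
  unfolding exchange_def
proof
  fix z assume z: "z \<in> square_integrable M"
  let ?f = "\<lambda>x. z x + w x + v x"
  have "H_trunc c ?f z = (\<lambda>x. z x + v x)"
  proof
    fix x show "H_trunc c ?f z x = z x + v x"
      using vw(1-3)[of x] vw(4)[of x] \<open>0 \<le> c\<close> unfolding H_trunc_def by (cases "w x = 0") auto
  qed
  moreover have "H_trunc c z ?f = (\<lambda>x. z x + w x)"
  proof
    fix x show "H_trunc c z ?f x = z x + w x"
      using vw(1-3)[of x] vw(4)[of x] \<open>0 \<le> c\<close> unfolding H_trunc_def by (cases "w x = 0") auto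
  qed
  ultimately show "E (L2_class M (\<lambda>x. z x + w x)) + E (L2_class M (\<lambda>x. z x + v x))
      \<le> E (L2_class M z) + E (L2_class M ?f)"
    using H[of ?f z c] z sq \<open>0 \<le> c\<close> by (simp add: square_integrable_intros add.commute)
qed

text \<open>
  Adding \<open>p + q\<close> to \<open>z\<close> raises it on one set and lowers it on a disjoint one, so the two remaining
  vertices of the parallelogram are the maximum and the minimum of \<open>z\<close> and \<open>z + p + q\<close>.
\<close>

lemma exchange_opposite_signs:
  assumes lattice: "\<And>f g. f \<in> square_integrable M \<Longrightarrow> g \<in> square_integrable M \<Longrightarrow>
      E (L2_class M (\<lambda>x. max (f x) (g x))) + E (L2_class M (\<lambda>x. min (f x) (g x)))
        \<le> E (L2_class M f) + E (L2_class M g)"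
    and sq: "p \<in> square_integrable M" "q \<in> square_integrable M"
    and pq: "\<And>x. 0 \<le> p x \<and> q x = 0 \<or> p x = 0 \<and> q x \<le> 0"
  shows "exchange M E p q"
  unfolding exchange_def
proof
  fix z assume z: "z \<in> square_integrable M"
  let ?f = "\<lambda>x. z x + p x + q x"
  have "(\<lambda>x. max (?f x) (z x)) = (\<lambda>x. z x + p x)" "(\<lambda>x. min (?f x) (z x)) = (\<lambda>x. z x + q x)"
    unfolding fun_eq_iff using pq by (smt (verit))+
  then show "E (L2_class M (\<lambda>x. z x + p x)) + E (L2_class M (\<lambda>x. z x + q x))
      \<le> E (L2_class M z) + E (L2_class M ?f)"
    using lattice[of ?f z] z sq by (simp add: square_integrable_intros add.commute)
qed

section \<open>Contractions acting on nonnegative functions\<close>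

text \<open>
  The layers below the height \<open>N \<epsilon>\<close> are complemented by one unbounded layer above it, so that all
  layers together sum up to \<open>u\<close>. With \<open>\<epsilon> = 1 / (n + 1)\<close> and \<open>N = (n + 1)\<^sup>2\<close> the layers become thin
  while the height \<open>N \<epsilon> = n + 1\<close> tends to infinity; the convergence is dominated by \<open>u\<close>.
\<close>

lemma exchange_monotone_split:
  fixes A :: "real \<Rightarrow> real"
  assumes lsc: "L2_lower_semicontinuous M E"
    and H: "\<And>f g \<alpha>. f \<in> square_integrable M \<Longrightarrow> g \<in> square_integrable M \<Longrightarrow> 0 \<le> \<alpha> \<Longrightarrow>
      E (L2_class M (H_trunc \<alpha> f g)) + E (L2_class M (H_trunc \<alpha> g f))
        \<le> E (L2_class M f) + E (L2_class M g)"
    and u: "u \<in> square_integrable M" "\<And>x. 0 \<le> u x"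
    and Au: "(\<lambda>x. A (u x)) \<in> square_integrable M"
    and A0: "A 0 = 0"
    and A: "\<And>s t. 0 \<le> s \<Longrightarrow> s \<le> t \<Longrightarrow> A s \<le> A t \<and> A t \<le> A s + (t - s)"
  shows "exchange M E (\<lambda>x. A (u x)) (\<lambda>x. u x - A (u x))"
proof -
  have [measurable]: "u \<in> borel_measurable M"
    using u by (simp add: square_integrable_def)
  define \<epsilon> :: "nat \<Rightarrow> real" where "\<epsilon> n = 1 / real (Suc n)" for n
  define N :: "nat \<Rightarrow> nat" where "N n = Suc n * Suc n" for n
  have \<epsilon>: "0 < \<epsilon> n" for n by (simp add: \<epsilon>_def)
  have N\<epsilon>: "real (N n) * \<epsilon> n = real (Suc n)" for n
    by (simp add: N_def \<epsilon>_def field_simps)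
  have "\<exists>I. I \<subseteq> {..<N n} \<and> (\<forall>t. 0 \<le> t \<longrightarrow> t < real (N n) * \<epsilon> n \<longrightarrow>
      \<bar>(\<Sum>i\<in>I. layer (\<epsilon> n) i t) - A t\<bar> \<le> 2 * \<epsilon> n)" for n
    using layers_approximate[of A "\<epsilon> n" "N n"] A0 A \<epsilon>[of n] by metis
  then obtain I where I: "\<And>n. I n \<subseteq> {..<N n}"
    and approx: "\<And>n t. 0 \<le> t \<Longrightarrow> t < real (N n) * \<epsilon> n \<Longrightarrow>
      \<bar>(\<Sum>i\<in>I n. layer (\<epsilon> n) i t) - A t\<bar> \<le> 2 * \<epsilon> n"
    by metis
  define a where "a n x = (\<Sum>i\<in>I n. layer (\<epsilon> n) i (u x))" for n x
  have layer_sq: "(\<lambda>x. layer \<delta> i (u x)) \<in> square_integrable M" if "0 < \<delta>" for \<delta> i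
  proof (rule square_integrable_dominated[OF u(1) square_integrable_zero])
    show "\<bar>layer \<delta> i (u x)\<bar> \<le> \<bar>u x\<bar> + \<bar>0\<bar>" for x
      using u(2)[of x] that mult_nonneg_nonneg[of "real i" \<delta>] unfolding layer_def
      by linarith
  qed (simp add: layer_def)
  have a_sq: "a n \<in> square_integrable M" for n
    unfolding a_def[abs_def] using layer_sq[OF \<epsilon>] by (rule square_integrable_sum)
  have a_bounds: "0 \<le> a n x" "a n x \<le> u x" for n x
  proof -
    have nonneg: "0 \<le> layer (\<epsilon> n) i (u x)" for i
      using \<epsilon>[of n] by (simp add: layer_def)
    then show "0 \<le> a n x" unfolding a_def by (intro sum_nonneg)
    have "a n x \<le> (\<Sum>i<N n. layer (\<epsilon> n) i (u x))"
      unfolding a_def using I nonneg by (intro sum_mono2) auto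
    also have "\<dots> \<le> u x"
      using \<epsilon>[of n] u(2)[of x] by (simp add: sum_layers)
    finally show "a n x \<le> u x" .
  qed
  show ?thesis
  proof (rule exchange_limit[OF lsc Au u(1) a_sq])
    show "exchange M E (a n) (\<lambda>x. u x - a n x)" for n
    proof -
      define tail where "tail x = max 0 (u x - real (N n) * \<epsilon> n)" for x
      \<comment> \<open>The index \<open>N n\<close> is the unbounded layer; it is given to the complement \<open>J\<close>.\<close>
      define l where "l i x = (if i < N n then layer (\<epsilon> n) i (u x) else tail x)" for i x
      define J where "J = {..N n} - I n"
      have tail_sq: "tail \<in> square_integrable M"
      proof (rule square_integrable_dominated[OF u(1) square_integrable_zero])
        show "\<bar>tail x\<bar> \<le> \<bar>u x\<bar> + \<bar>0\<bar>" for x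
          using u(2)[of x] N\<epsilon>[of n] by (simp add: tail_def)
      qed (simp add: tail_def[abs_def])
      have l_sq: "l i \<in> square_integrable M" for i
        using layer_sq[OF \<epsilon>[of n], of i] tail_sq
        by (cases "i < N n") (simp_all add: l_def[abs_def])
      have "exchange M E (\<lambda>x. \<Sum>i\<in>I n. l i x) (\<lambda>x. \<Sum>i\<in>J. l i x)"
      proof (rule exchange_layers[where k = "Suc (N n)"])
        fix k S assume k: "k < Suc (N n)" and S: "S \<subseteq> {..<k}"
        have S_layer: "l i x = layer (\<epsilon> n) i (u x)" if "i \<in> S" for i x
          using that S k by (auto simp: l_def)
        have l_le: "0 \<le> l i x \<and> l i x \<le> \<epsilon> n" if "i \<in> S" for i x
          using S_layer[OF that] \<epsilon>[of n] by (simp add: layer_def)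
        \<comment> \<open>Where the layer \<open>k\<close> is nonzero, the graph of \<open>u\<close> has passed all lower layers.\<close>
        have l_full: "l i x = \<epsilon> n" if "i \<in> S" "0 < l k x" for i x
        proof -
          have "real k * \<epsilon> n < u x"
            using that(2) k by (auto simp: l_def tail_def layer_def less_Suc_eq split: if_splits)
          moreover have "(real i + 1) * \<epsilon> n \<le> real k * \<epsilon> n"
            using that(1) S \<epsilon>[of n] by (intro mult_right_mono) auto
          ultimately show ?thesis
            using S_layer[OF that(1)] \<epsilon>[of n] by (simp add: layer_def algebra_simps)
        qed
        show "exchange M E (l k) (\<lambda>x. \<Sum>i\<in>S. l i x)"
        proof (rule exchange_above[where c = "real (card S) * \<epsilon> n", OF H])
          show "0 \<le> l k x" for x
            using \<epsilon>[of n] by (simp add: l_def layer_def tail_def)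
          show "(\<Sum>i\<in>S. l i x) \<le> real (card S) * \<epsilon> n" for x
            using l_le by (intro sum_bounded_above) auto
          show "(\<Sum>i\<in>S. l i x) = real (card S) * \<epsilon> n" if "0 < l k x" for x
            using l_full[OF _ that] by simp
        qed (use l_le \<epsilon>[of n] in \<open>auto intro!: l_sq square_integrable_sum sum_nonneg\<close>)
      qed (use I[of n] l_sq in \<open>auto simp: J_def less_Suc_eq\<close>)
      moreover have sum_I: "(\<Sum>i\<in>I n. l i x) = a n x" for x
        unfolding a_def using I[of n] by (intro sum.cong) (auto simp: l_def)
      moreover have "(\<Sum>i\<in>J. l i x) = u x - a n x" for x
      proof -
        have "(\<Sum>i\<le>N n. l i x) = (\<Sum>i<N n. layer (\<epsilon> n) i (u x)) + tail x"
          by (simp add: l_def flip: lessThan_Suc_atMost)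
        also have "\<dots> = u x"
          using \<epsilon>[of n] u(2)[of x] by (simp add: sum_layers tail_def)
        finally show ?thesis
          unfolding J_def using I[of n]
          by (subst sum_diff) (auto simp: sum_I)
      qed
      ultimately show ?thesis by simp
    qed
    show "(\<lambda>n. L2_norm M (\<lambda>x. a n x - A (u x))) \<longlonglongrightarrow> 0"
    proof (rule L2_norm_tendsto_dominated[OF Au u(1) a_sq])
      show "\<bar>a n x - A (u x)\<bar> \<le> \<bar>u x\<bar>" for n x
        using a_bounds[where x = x] A[of 0 "u x"] u(2)[of x] A0
        by (smt (verit))
      fix x
      have "(\<lambda>n. a n x - A (u x)) \<longlonglongrightarrow> 0"
      proof (rule Lim_null_comparison)
        obtain n0 :: nat where "u x < real n0" using reals_Archimedean2 by blast
        then have "\<bar>a n x - A (u x)\<bar> \<le> 2 * \<epsilon> n" if "n0 \<le> n" for n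
          unfolding a_def using that u(2)[of x] by (intro approx) (auto simp: N\<epsilon>)
        then show "\<forall>\<^sub>F n in sequentially. norm (a n x - A (u x)) \<le> 2 * \<epsilon> n"
          unfolding eventually_sequentially by auto
        have "(\<lambda>n. 2 * \<epsilon> n) \<longlonglongrightarrow> 2 * 0"
          unfolding \<epsilon>_def using LIMSEQ_inverse_real_of_nat
          by (intro tendsto_mult tendsto_const) (simp add: inverse_eq_divide)
        then show "(\<lambda>n. 2 * \<epsilon> n) \<longlonglongrightarrow> 0" by simp
      qed
      then show "(\<lambda>n. a n x) \<longlonglongrightarrow> A (u x)" by (rule LIM_zero_cancel)
    qed
  qed
qed

section \<open>From the lattice and truncation inequalities to all contractions\<close>

text \<open>
  The four mixed pairs of a nonnegative and a nonpositive increment are exchangeable by the lattice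
  inequality, and so are the mixed pairs formed with the sums \<open>a + b\<close> and \<open>c + d\<close>. Additivity then
  first replaces \<open>b\<close> by \<open>b + d\<close> (lemmas \<open>a_rest\<close> and \<open>c_rest\<close> in the proof) and next \<open>a\<close> by \<open>a + c\<close>.
  The sums enter as the finiteness hypotheses of \<open>exchange_add\<close>.
\<close>

lemma exchange_combine_signs:
  assumes lattice: "\<And>f g. f \<in> square_integrable M \<Longrightarrow> g \<in> square_integrable M \<Longrightarrow>
      E (L2_class M (\<lambda>x. max (f x) (g x))) + E (L2_class M (\<lambda>x. min (f x) (g x)))
        \<le> E (L2_class M f) + E (L2_class M g)"
    and sq: "a \<in> square_integrable M" "b \<in> square_integrable M"
      "c \<in> square_integrable M" "d \<in> square_integrable M"
    and pos: "exchange M E a b" and neg: "exchange M E c d"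
    and signs: "\<And>x. 0 \<le> a x \<and> 0 \<le> b x \<and> c x = 0 \<and> d x = 0
      \<or> a x = 0 \<and> b x = 0 \<and> c x \<le> 0 \<and> d x \<le> 0"
  shows "exchange M E (\<lambda>x. a x + c x) (\<lambda>x. b x + d x)"
proof -
  have sum_sq: "(\<lambda>x. a x + b x) \<in> square_integrable M" "(\<lambda>x. c x + d x) \<in> square_integrable M"
    using sq by (auto intro: square_integrable_add)
  have opp: "exchange M E r s"
    if "r \<in> {a, b, \<lambda>x. a x + b x}" and "s \<in> {c, d, \<lambda>x. c x + d x}" for r s
  proof (rule exchange_opposite_signs[OF lattice])
    show "r \<in> square_integrable M" "s \<in> square_integrable M"
      using that sq sum_sq by auto
    show "0 \<le> r x \<and> s x = 0 \<or> r x = 0 \<and> s x \<le> 0" for x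
      using that signs[of x] by auto
  qed
  have a_rest: "exchange M E a (\<lambda>x. b x + s x)" if s: "s \<in> {d, \<lambda>x. c x + d x}" for s
  proof -
    have "exchange M E (\<lambda>x. s x + b x) a"
    proof (rule exchange_add)
      show "s \<in> square_integrable M" using s sq sum_sq by auto
      have "exchange M E a s" using s by (intro opp) auto
      then show "exchange M E s a" by (simp only: exchange_commute)
      have "exchange M E (\<lambda>x. a x + b x) s" using s by (intro opp) auto
      then show "exchange M E s (\<lambda>x. b x + a x)"
        by (simp only: exchange_commute[of M E s] add.commute)
      show "exchange M E b a" using pos by (simp only: exchange_commute)
    qed
    then show ?thesis by (simp only: exchange_commute[of M E a] add.commute)
  qed
  have c_rest: "exchange M E c (\<lambda>x. b x + d x)"
  proof -
    have "exchange M E (\<lambda>x. b x + d x) c"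
    proof (rule exchange_add[OF sq(2)])
      show "exchange M E b c" by (intro opp) auto
      have "exchange M E b (\<lambda>x. c x + d x)" by (intro opp) auto
      then show "exchange M E b (\<lambda>x. d x + c x)" by (simp only: add.commute)
      show "exchange M E d c" using neg by (simp only: exchange_commute)
    qed
    then show ?thesis by (simp only: exchange_commute)
  qed
  show ?thesis
  proof (rule exchange_add[OF sq(1) _ _ c_rest])
    show "exchange M E a (\<lambda>x. b x + d x)" by (rule a_rest) auto
    show "exchange M E a (\<lambda>x. c x + (b x + d x))"
      using a_rest[of "\<lambda>x. c x + d x"] by (simp add: add.left_commute)
  qed
qed

text \<open>
  For \<open>w \<ge> 0\<close> the increments \<open>w + C w\<close> and \<open>w - C w\<close> split \<open>u = 2 w\<close> by the function
  \<open>A(t) = t / 2 + C (t / 2)\<close>, which is nondecreasing and 1-Lipschitz because \<open>C\<close> is a contraction.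
  This applies directly to the positive part \<open>p\<close> of \<open>g\<close>. For the nonpositive part \<open>n\<close> of \<open>g\<close> it
  applies to \<open>-n\<close> with the reflected contraction \<open>t \<mapsto> -C(-t)\<close>.
\<close>

lemma contraction_property_of_lattice_truncation:
  assumes lsc: "L2_lower_semicontinuous M E"
    and lattice: "\<And>f g. f \<in> square_integrable M \<Longrightarrow> g \<in> square_integrable M \<Longrightarrow>
      E (L2_class M (\<lambda>x. max (f x) (g x))) + E (L2_class M (\<lambda>x. min (f x) (g x)))
        \<le> E (L2_class M f) + E (L2_class M g)"
    and truncation: "\<And>f g \<alpha>. f \<in> square_integrable M \<Longrightarrow> g \<in> square_integrable M \<Longrightarrow> 0 \<le> \<alpha> \<Longrightarrow>
      E (L2_class M (H_trunc \<alpha> f g)) + E (L2_class M (H_trunc \<alpha> g f))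
        \<le> E (L2_class M f) + E (L2_class M g)"
  shows "contraction_property M E"
  unfolding contraction_property_def compatible_def
proof (intro allI impI ballI)
  fix C f g assume C: "normal_contraction C"
    and f: "f \<in> square_integrable M" and g: "g \<in> square_integrable M"
  have C0: "C 0 = 0" and lip: "\<bar>C s - C t\<bar> \<le> \<bar>s - t\<bar>" for s t
    using C by (auto simp: normal_contraction_def)
  have halves: "exchange M E (\<lambda>x. w x + D (w x)) (\<lambda>x. w x - D (w x))"
    if D: "normal_contraction D" and w: "w \<in> square_integrable M" "\<And>x. 0 \<le> w x" for D w
  proof -
    let ?A = "\<lambda>t. t / 2 + D (t / 2)"
    have "exchange M E (\<lambda>x. ?A (2 * w x)) (\<lambda>x. 2 * w x - ?A (2 * w x))"
    proof (rule exchange_monotone_split[OF lsc truncation, where A = ?A and u = "\<lambda>x. 2 * w x"])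
      show "(\<lambda>x. 2 * w x) \<in> square_integrable M"
        using w(1) by (rule square_integrable_scale)
      show "(\<lambda>x. ?A (2 * w x)) \<in> square_integrable M"
        using square_integrable_contraction(1)[OF D w(1) w(1)] by simp
      show "?A s \<le> ?A t \<and> ?A t \<le> ?A s + (t - s)" if "s \<le> t" for s t
      proof -
        have "\<bar>D (s / 2) - D (t / 2)\<bar> \<le> \<bar>s / 2 - t / 2\<bar>"
          using D by (simp add: normal_contraction_def)
        with that show ?thesis by (intro conjI) linarith+
      qed
    qed (use w D in \<open>auto simp: normal_contraction_def\<close>)
    then show ?thesis by simp
  qed

  define p n where "p x = max (g x) 0" and "n x = min (g x) 0" for x
  have p: "p \<in> square_integrable M" and n: "n \<in> square_integrable M"
    unfolding p_def[abs_def] n_def[abs_def]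
    using g square_integrable_zero by (rule square_integrable_lattice)+
  have pos: "exchange M E (\<lambda>x. p x + C (p x)) (\<lambda>x. p x - C (p x))"
    using C p by (rule halves) (simp add: p_def)
  have reflected: "normal_contraction (\<lambda>t. - C (- t))"
    unfolding normal_contraction_def
  proof (intro conjI allI)
    show "\<bar>- C (- s) - - C (- t)\<bar> \<le> \<bar>s - t\<bar>" for s t
      using lip[of "- s" "- t"] by linarith
  qed (simp add: C0)
  have minus_n: "(\<lambda>x. - n x) \<in> square_integrable M"
    using n by (rule square_integrable_uminus)
  have "exchange M E (\<lambda>x. - n x + - C (- (- n x))) (\<lambda>x. - n x - - C (- (- n x)))"
    using reflected minus_n by (rule halves) (simp add: n_def)
  then have "exchange M E (\<lambda>x. - (- n x + - C (- (- n x)))) (\<lambda>x. - (- n x - - C (- (- n x))))"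
    by (rule exchange_uminus[OF square_integrable_contraction[OF reflected minus_n minus_n]])
  then have neg: "exchange M E (\<lambda>x. n x + C (n x)) (\<lambda>x. n x - C (n x))"
    by (simp add: add.commute)
  have "exchange M E (\<lambda>x. (p x + C (p x)) + (n x + C (n x))) (\<lambda>x. (p x - C (p x)) + (n x - C (n x)))"
  proof (rule exchange_combine_signs[OF lattice
        square_integrable_contraction[OF C p p] square_integrable_contraction[OF C n n] pos neg])
    show "0 \<le> p x + C (p x) \<and> 0 \<le> p x - C (p x) \<and> n x + C (n x) = 0 \<and> n x - C (n x) = 0
        \<or> p x + C (p x) = 0 \<and> p x - C (p x) = 0 \<and> n x + C (n x) \<le> 0 \<and> n x - C (n x) \<le> 0" for x
      using lip[of "g x" 0] C0 by (cases "0 \<le> g x") (auto simp: p_def n_def)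
  qed
  moreover have "(p x + C (p x)) + (n x + C (n x)) = g x + C (g x)"
    "(p x - C (p x)) + (n x - C (n x)) = g x - C (g x)" for x
    by (cases "0 \<le> g x"; simp add: p_def n_def C0)+
  ultimately have ex: "exchange M E (\<lambda>x. g x + C (g x)) (\<lambda>x. g x - C (g x))"
    by simp
  have "(\<lambda>x. f x - g x) \<in> square_integrable M"
    using f g by (rule square_integrable_diff)
  from ex[unfolded exchange_def, rule_format, OF this]
  show "E (L2_class M (\<lambda>x. f x + C (g x))) + E (L2_class M (\<lambda>x. f x - C (g x)))
      \<le> E (L2_class M (\<lambda>x. f x + g x)) + E (L2_class M (\<lambda>x. f x - g x))"
    by (simp add: algebra_simps)
qed

section \<open>From the two families of contractions to the lattice and truncation inequalities\<close>

text \<open>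
  Compatibility is stated around the centre \<open>s = (f + g) / 2\<close> of a segment; here it is expressed by
  its end points \<open>f = s + d\<close> and \<open>g = s - d\<close>.
\<close>

lemma compatible_endpoints:
  assumes C: "compatible M E C"
    and f: "f \<in> square_integrable M" and g: "g \<in> square_integrable M"
    and h: "\<And>x s d. f x = s + d \<Longrightarrow> g x = s - d \<Longrightarrow> h x = s + C d"
    and k: "\<And>x s d. f x = s + d \<Longrightarrow> g x = s - d \<Longrightarrow> k x = s - C d"
  shows "E (L2_class M h) + E (L2_class M k) \<le> E (L2_class M f) + E (L2_class M g)"
proof -
  let ?s = "\<lambda>x. (f x + g x) / 2" and ?d = "\<lambda>x. (f x - g x) / 2"
  have "?s \<in> square_integrable M" "?d \<in> square_integrable M"
    using square_integrable_scale[OF square_integrable_add[OF f g], of "1 / 2"]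
      square_integrable_scale[OF square_integrable_diff[OF f g], of "1 / 2"] by simp_all
  note compat = C[unfolded compatible_def, rule_format, OF this]
  have sd: "f x = ?s x + ?d x" "g x = ?s x - ?d x" for x
    by (simp_all add: field_simps)
  have "(\<lambda>x. ?s x + C (?d x)) = h" "(\<lambda>x. ?s x - C (?d x)) = k"
    using h[OF sd] k[OF sd] by (simp_all add: fun_eq_iff)
  moreover have "(\<lambda>x. ?s x + ?d x) = f" "(\<lambda>x. ?s x - ?d x) = g"
    using sd by (simp_all add: fun_eq_iff)
  ultimately show ?thesis using compat by simp
qed

lemma lattice_of_compatible_abs:
  assumes "compatible M E abs" "f \<in> square_integrable M" "g \<in> square_integrable M"
  shows "E (L2_class M (\<lambda>x. max (f x) (g x))) + E (L2_class M (\<lambda>x. min (f x) (g x)))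
    \<le> E (L2_class M f) + E (L2_class M g)"
proof (rule compatible_endpoints[OF assms])
  show "max (f x) (g x) = s + \<bar>d\<bar>" "min (f x) (g x) = s - \<bar>d\<bar>"
    if "f x = s + d" "g x = s - d" for x s d
    using that by (auto simp: max_def min_def)
qed

lemma truncation_of_compatible_C_contr:
  assumes "compatible M E (C_contr \<alpha>)" "f \<in> square_integrable M" "g \<in> square_integrable M"
    and "0 \<le> \<alpha>"
  shows "E (L2_class M (H_trunc \<alpha> f g)) + E (L2_class M (H_trunc \<alpha> g f))
    \<le> E (L2_class M f) + E (L2_class M g)"
proof (rule compatible_endpoints[OF assms(1-3)])
  show "H_trunc \<alpha> f g x = s + C_contr \<alpha> d" "H_trunc \<alpha> g f x = s - C_contr \<alpha> d"
    if "f x = s + d" "g x = s - d" for x s d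
    using that assms(4) by (auto simp: H_trunc_def C_contr_def max_def min_def)
qed

section \<open>The equivalence\<close>

theorem theorem3:
  fixes M :: "'a measure" and E :: "('a \<Rightarrow> real) set \<Rightarrow> ennreal"
  assumes "L2_lower_semicontinuous M E"
  shows
    "(contraction_property M E
        \<longleftrightarrow> compatible M E abs \<and> (\<forall>\<alpha>\<ge>0. compatible M E (C_contr \<alpha>)))
     \<and>
     (compatible M E abs \<and> (\<forall>\<alpha>\<ge>0. compatible M E (C_contr \<alpha>))
        \<longleftrightarrow> (\<forall>f \<in> square_integrable M. \<forall>g \<in> square_integrable M. \<forall>\<alpha>\<ge>0.
              E (L2_class M (\<lambda>x. max (f x) (g x))) + E (L2_class M (\<lambda>x. min (f x) (g x)))
                \<le> E (L2_class M f) + E (L2_class M g)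
            \<and> E (L2_class M (H_trunc \<alpha> f g)) + E (L2_class M (H_trunc \<alpha> g f))
                \<le> E (L2_class M f) + E (L2_class M g)))"
    (is "(?i \<longleftrightarrow> ?ii) \<and> (?ii \<longleftrightarrow> ?iii)")
proof -
  have "?i \<Longrightarrow> ?ii"
    by (simp add: contraction_property_def normal_contraction_abs normal_contraction_C_contr)
  moreover have "?ii \<Longrightarrow> ?iii"
    using lattice_of_compatible_abs truncation_of_compatible_C_contr by blast
  moreover have "?iii \<Longrightarrow> ?i"
    by (rule contraction_property_of_lattice_truncation[OF assms]) auto
  ultimately show ?thesis by blast
qed

end
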